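(* For a two-player stage game $G$, we have $G\notin\mathcal{G}_{LS}^{p,p}$ and $G\in\mathcal{G}_{LS}^{m,m}$ if and only if one of the following holds: (1) $|V_1^{p,p}|=0$, $|V_2^{p,p}|=0$, and $\mathcal{C}^{m,m}(G)$ holds; (2) $|V_1^{p,p}|=1$, $|V_2^{p,p}|=1$, and $\mathcal{C}^{m,m}(G)$ holds; (3) $|V_1^{p,p}|>1$, $|V_2^{p,p}|=1$, $\mathcal{C}^{p,p}(G)$ does not hold, and $\mathcal{C}^{m,m}(G)$ holds; (4) $|V_1^{p,p}|=1$, $|V_2^{p,p}|>1$, $\mathcal{C}^{p,p}(G)$ does not hold, and $\mathcal{C}^{m,m}(G)$ holds.
   Context: A two-player stage game $G$ has finite nonempty action sets $A_1,A_2$ and payoffs $u_1,u_2:A_1\times A_2\to\mathbb{R}$, extended to mixed strategies by expectation; best response means maximizing expected payoff against the opponent's strategy. $G(T)$ is the $T$-round repetition with realized actions observed each round and payoffs the expected sum of stage payoffs; an SPE of $G(T)$ is a strategy profile whose continuation after every history of length $k<T$ is a Nash equilibrium of $G(T-k)$. Regimes: pure-pure ($p,p$): both players restricted to actions (in the stage game and in every round, including deviations); mixed-pure ($m,p$): player 1 may mix, player 2 uses only actions; mixed-mixed ($m,m$): both may mix. For regime $r$, $\mathrm{Nash}^r(G)$ is the set of stage-game profiles available in $r$ from which no player can profitably deviate unilaterally to a strategy available in $r$, and $V_i^r=\{u_i(\sigma):\sigma\in\mathrm{Nash}^r(G)\}$. Locally suboptimal behavior occurs in an SPE $\mu$ of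 $G(T)$ (regime $r$) if for some history $h$ of length $k<T$, $(\mu_1(h),\mu_2(h))\notin\mathrm{Nash}^r(G)$. $\mathcal{G}_{LS}^r$ is the set of stage games $G$ for which there exist $T\ge1$ and an SPE of $G(T)$ in regime $r$ in which locally suboptimal behavior occurs. Condition $\mathcal{C}^{p,p}(G)$ holds iff one of: (i) $|V_1^{p,p}|>1$, $|V_2^{p,p}|>1$, and some $(\hat a_1,\hat a_2)\in A_1\times A_2$ is not in $\mathrm{Nash}^{p,p}(G)$; (ii) $|V_1^{p,p}|>1$, $|V_2^{p,p}|=1$, and there exist $\hat a_1,a_1'\in A_1$, $\hat a_2\in A_2$ with $u_1(\hat a_1,\hat a_2)<u_1(a_1',\hat a_2)$ and $\hat a_2$ a best response to $\hat a_1$; (iii) $|V_1^{p,p}|=1$, $|V_2^{p,p}|>1$, and there exist $\hat a_1\in A_1$, $\hat a_2,a_2'\in A_2$ with $u_2(\hat a_1,\hat a_2)<u_2(\hat a_1,a_2')$ and $\hat a_1$ a best response to $\hat a_2$. Condition $\mathcal{C}^{m,m}(G)$ holds iff one of: (i) $|V_1^{m,m}|>1$, $|V_2^{m,m}|>1$, and some $(\hat\sigma_1,\hat\sigma_2)\in\Delta A_1\times\Delta A_2$ is not in $\mathrm{Nash}^{m,m}(G)$; (ii) $|V_1^{m,m}|>1$, $|V_2^{m,m}|=1$, and there exist $\hat\sigma_1,\hat\sigma_2$, $a_1'\in A_1$ with $u_1(\hat\sigma_1,\hat\sigma_2)<u_1(a_1',\hat\sigma_2)$ and $\hat\sigma_2$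 a best response to $\hat\sigma_1$; (iii) $|V_1^{m,m}|=1$, $|V_2^{m,m}|>1$, and there exist $\hat\sigma_1,\hat\sigma_2$, $a_2'\in A_2$ with $u_2(\hat\sigma_1,\hat\sigma_2)<u_2(\hat\sigma_1,a_2')$ and $\hat\sigma_1$ a best response to $\hat\sigma_2$. *)

theory Defs
  imports Complex_Main
begin

text \<open>Stage game: finite nonempty action types 'a (player 1) and 'b (player 2),
  payoffs u1 u2 :: 'a => 'b => real. Mixed strategies are probability
  vectors on the (finite) action type.\<close>

datatype regime = PP | MP | MM

definition simplex :: "('x::finite \<Rightarrow> real) set" where
  "simplex = {p. (\<forall>x. 0 \<le> p x) \<and> (\<Sum>x\<in>UNIV. p x) = 1}"

definition pure :: "'x \<Rightarrow> ('x \<Rightarrow> real)" where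
  "pure a = (\<lambda>x. if x = a then 1 else 0)"

definition pure_strats :: "('x \<Rightarrow> real) set" where
  "pure_strats = range pure"

definition avail1 :: "regime \<Rightarrow> ('x::finite \<Rightarrow> real) set" where
  "avail1 r = (if r = PP then pure_strats else simplex)"

definition avail2 :: "regime \<Rightarrow> ('x::finite \<Rightarrow> real) set" where
  "avail2 r = (if r = MM then simplex else pure_strats)"

definition EU :: "('a::finite \<Rightarrow> 'b::finite \<Rightarrow> real) \<Rightarrow> ('a \<Rightarrow> real) \<Rightarrow> ('b \<Rightarrow> real) \<Rightarrow> real" where
  "EU u s1 s2 = (\<Sum>a1\<in>UNIV. \<Sum>a2\<in>UNIV. s1 a1 * s2 a2 * u a1 a2)"

definition best_resp1 :: "regime \<Rightarrow> ('a::finite \<Rightarrow> 'b::finite \<Rightarrow> real) \<Rightarrow> ('a \<Rightarrow> real) \<Rightarrow> ('b \<Rightarrow> real) \<Rightarrow> bool" where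
  "best_resp1 r u1 s1 s2 \<longleftrightarrow> s1 \<in> avail1 r \<and> (\<forall>t1\<in>avail1 r. EU u1 t1 s2 \<le> EU u1 s1 s2)"

definition best_resp2 :: "regime \<Rightarrow> ('a::finite \<Rightarrow> 'b::finite \<Rightarrow> real) \<Rightarrow> ('a \<Rightarrow> real) \<Rightarrow> ('b \<Rightarrow> real) \<Rightarrow> bool" where
  "best_resp2 r u2 s1 s2 \<longleftrightarrow> s2 \<in> avail2 r \<and> (\<forall>t2\<in>avail2 r. EU u2 s1 t2 \<le> EU u2 s1 s2)"

definition Nash :: "regime \<Rightarrow> ('a::finite \<Rightarrow> 'b::finite \<Rightarrow> real) \<Rightarrow> ('a \<Rightarrow> 'b \<Rightarrow> real)
    \<Rightarrow> (('a \<Rightarrow> real) \<times> ('b \<Rightarrow> real)) set" where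
  "Nash r u1 u2 = {(s1, s2). s1 \<in> avail1 r \<and> s2 \<in> avail2 r \<and>
      (\<forall>t1\<in>avail1 r. EU u1 t1 s2 \<le> EU u1 s1 s2) \<and>
      (\<forall>t2\<in>avail2 r. EU u2 s1 t2 \<le> EU u2 s1 s2)}"

definition V1 :: "regime \<Rightarrow> ('a::finite \<Rightarrow> 'b::finite \<Rightarrow> real) \<Rightarrow> ('a \<Rightarrow> 'b \<Rightarrow> real) \<Rightarrow> real set" where
  "V1 r u1 u2 = (\<lambda>(s1, s2). EU u1 s1 s2) ` Nash r u1 u2"

definition V2 :: "regime \<Rightarrow> ('a::finite \<Rightarrow> 'b::finite \<Rightarrow> real) \<Rightarrow> ('a \<Rightarrow> 'b \<Rightarrow> real) \<Rightarrow> real set" where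
  "V2 r u1 u2 = (\<lambda>(s1, s2). EU u2 s1 s2) ` Nash r u1 u2"

text \<open>Cardinality predicates |V| = 1 and |V| > 1 (V may be infinite in the mixed regime).\<close>
definition card_one :: "'x set \<Rightarrow> bool" where
  "card_one V \<longleftrightarrow> (\<exists>v. V = {v})"

definition card_gt1 :: "'x set \<Rightarrow> bool" where
  "card_gt1 V \<longleftrightarrow> (\<exists>x\<in>V. \<exists>y\<in>V. x \<noteq> y)"

text \<open>Repeated game G(T). Histories are lists of realized action pairs (oldest first).
  A strategy maps histories to stage strategies. Expected total payoff of the
  remaining n rounds after history h:\<close>
fun rep_pay :: "('a::finite \<Rightarrow> 'b::finite \<Rightarrow> real) \<Rightarrow> (('a \<times> 'b) list \<Rightarrow> 'a \<Rightarrow> real)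
    \<Rightarrow> (('a \<times> 'b) list \<Rightarrow> 'b \<Rightarrow> real) \<Rightarrow> nat \<Rightarrow> ('a \<times> 'b) list \<Rightarrow> real" where
  "rep_pay u m1 m2 0 h = 0"
| "rep_pay u m1 m2 (Suc n) h =
     (\<Sum>a1\<in>UNIV. \<Sum>a2\<in>UNIV. m1 h a1 * m2 h a2 * (u a1 a2 + rep_pay u m1 m2 n (h @ [(a1, a2)])))"

definition strat1 :: "regime \<Rightarrow> (('a::finite \<times> 'b::finite) list \<Rightarrow> 'a \<Rightarrow> real) \<Rightarrow> bool" where
  "strat1 r m1 \<longleftrightarrow> (\<forall>h. m1 h \<in> avail1 r)"

definition strat2 :: "regime \<Rightarrow> (('a::finite \<times> 'b::finite) list \<Rightarrow> 'b \<Rightarrow> real) \<Rightarrow> bool" where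
  "strat2 r m2 \<longleftrightarrow> (\<forall>h. m2 h \<in> avail2 r)"

definition NE_rep :: "regime \<Rightarrow> ('a::finite \<Rightarrow> 'b::finite \<Rightarrow> real) \<Rightarrow> ('a \<Rightarrow> 'b \<Rightarrow> real) \<Rightarrow> nat
    \<Rightarrow> (('a \<times> 'b) list \<Rightarrow> 'a \<Rightarrow> real) \<Rightarrow> (('a \<times> 'b) list \<Rightarrow> 'b \<Rightarrow> real) \<Rightarrow> bool" where
  "NE_rep r u1 u2 n m1 m2 \<longleftrightarrow> strat1 r m1 \<and> strat2 r m2 \<and>
     (\<forall>d1. strat1 r d1 \<longrightarrow> rep_pay u1 d1 m2 n [] \<le> rep_pay u1 m1 m2 n []) \<and>
     (\<forall>d2. strat2 r d2 \<longrightarrow> rep_pay u2 m1 d2 n [] \<le> rep_pay u2 m1 m2 n [])"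

definition cont :: "('h list \<Rightarrow> 'z) \<Rightarrow> 'h list \<Rightarrow> ('h list \<Rightarrow> 'z)" where
  "cont m h = (\<lambda>h'. m (h @ h'))"

definition SPE :: "regime \<Rightarrow> ('a::finite \<Rightarrow> 'b::finite \<Rightarrow> real) \<Rightarrow> ('a \<Rightarrow> 'b \<Rightarrow> real) \<Rightarrow> nat
    \<Rightarrow> (('a \<times> 'b) list \<Rightarrow> 'a \<Rightarrow> real) \<Rightarrow> (('a \<times> 'b) list \<Rightarrow> 'b \<Rightarrow> real) \<Rightarrow> bool" where
  "SPE r u1 u2 T m1 m2 \<longleftrightarrow> strat1 r m1 \<and> strat2 r m2 \<and>
     (\<forall>h. length h < T \<longrightarrow> NE_rep r u1 u2 (T - length h) (cont m1 h) (cont m2 h))"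

definition in_GLS :: "regime \<Rightarrow> ('a::finite \<Rightarrow> 'b::finite \<Rightarrow> real) \<Rightarrow> ('a \<Rightarrow> 'b \<Rightarrow> real) \<Rightarrow> bool" where
  "in_GLS r u1 u2 \<longleftrightarrow> (\<exists>T\<ge>1. \<exists>m1 m2. SPE r u1 u2 T m1 m2 \<and>
      (\<exists>h. length h < T \<and> (m1 h, m2 h) \<notin> Nash r u1 u2))"

definition C_pp :: "('a::finite \<Rightarrow> 'b::finite \<Rightarrow> real) \<Rightarrow> ('a \<Rightarrow> 'b \<Rightarrow> real) \<Rightarrow> bool" where
  "C_pp u1 u2 \<longleftrightarrow>
     (card_gt1 (V1 PP u1 u2) \<and> card_gt1 (V2 PP u1 u2) \<and>
        (\<exists>a1 a2. (pure a1, pure a2) \<notin> Nash PP u1 u2))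
   \<or> (card_gt1 (V1 PP u1 u2) \<and> card_one (V2 PP u1 u2) \<and>
        (\<exists>a1 a1' a2. u1 a1 a2 < u1 a1' a2 \<and> best_resp2 PP u2 (pure a1) (pure a2)))
   \<or> (card_one (V1 PP u1 u2) \<and> card_gt1 (V2 PP u1 u2) \<and>
        (\<exists>a1 a2 a2'. u2 a1 a2 < u2 a1 a2' \<and> best_resp1 PP u1 (pure a1) (pure a2)))"

definition C_mm :: "('a::finite \<Rightarrow> 'b::finite \<Rightarrow> real) \<Rightarrow> ('a \<Rightarrow> 'b \<Rightarrow> real) \<Rightarrow> bool" where
  "C_mm u1 u2 \<longleftrightarrow>
     (card_gt1 (V1 MM u1 u2) \<and> card_gt1 (V2 MM u1 u2) \<and>
        (\<exists>s1\<in>simplex. \<exists>s2\<in>simplex. (s1, s2) \<notin> Nash MM u1 u2))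
   \<or> (card_gt1 (V1 MM u1 u2) \<and> card_one (V2 MM u1 u2) \<and>
        (\<exists>s1\<in>simplex. \<exists>s2\<in>simplex. \<exists>a1'.
           EU u1 s1 s2 < EU u1 (pure a1') s2 \<and> best_resp2 MM u2 s1 s2))
   \<or> (card_one (V1 MM u1 u2) \<and> card_gt1 (V2 MM u1 u2) \<and>
        (\<exists>s1\<in>simplex. \<exists>s2\<in>simplex. \<exists>a2'.
           EU u2 s1 s2 < EU u2 s1 (pure a2') \<and> best_resp1 MM u1 s1 s2))"

end

theory Submission
  imports Defs
begin

text \<open>In a subgame perfect equilibrium, look at a longest history after which no stage equilibrium is
  played: all later rounds play stage equilibria, so a player with a unique equilibrium payoff has a
  constant continuation payoff and best responds myopically. Conversely, a suitable non-equilibrium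
  profile in the first round can be enforced by many rounds of good or bad stage equilibria.
  The delicate case is the mixed regime with \<open>|V\<^sub>2| = 1\<close>, because only realized actions are observed
  and continuation payoffs need not be fine enough to make player 1 indifferent on the support of a
  given mixed action. If some pure \<open>(a, b)\<close> with \<open>b\<close> a best response to \<open>a\<close> is not an equilibrium,
  enforce it. If some \<open>a\<close> has two best responses with different payoffs for player 1, the equilibrium
  payoffs of player 1 contain an interval, which is fine enough. Otherwise there are \<open>a, a'\<close> without
  common best response, and on the segment between them player 2 has a best response that makes
  player 1 indifferent between \<open>a\<close> and \<open>a'\<close>; player 2 then gets less than his unique equilibrium
  payoff, so this profile is not an equilibrium and rewards on its support need no fine tuning.\<close>

section \<open>Expected payoffs\<close>

lemma pure_apply: "pure a x = (if x = a then 1 else 0)"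
  by (simp add: pure_def)

lemma pure_in_simplex [simp]: "pure (a::'x::finite) \<in> simplex"
  by (auto simp: simplex_def pure_def)

lemma pure_in_avail [simp]: "pure (a::'x::finite) \<in> avail1 r" "pure a \<in> avail2 r"
  by (auto simp: avail1_def avail2_def pure_strats_def)

lemma avail_in_simplex:
  "s \<in> avail1 r \<Longrightarrow> s \<in> simplex" "t \<in> avail2 r \<Longrightarrow> t \<in> simplex"
  by (auto simp: avail1_def avail2_def pure_strats_def split: if_splits)

lemma simplex_sum: "s \<in> simplex \<Longrightarrow> sum s UNIV = 1"
  by (simp add: simplex_def)

lemma simplex_nonneg: "s \<in> simplex \<Longrightarrow> 0 \<le> s x"
  by (simp add: simplex_def)

lemma EU_pure_left: "EU u (pure a) t = (\<Sum>b\<in>UNIV. t b * u a b)"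
proof -
  have "EU u (pure a) t = (\<Sum>x\<in>UNIV. if x = a then (\<Sum>b\<in>UNIV. t b * u x b) else 0)"
    unfolding EU_def by (rule sum.cong) (auto simp: pure_def)
  then show ?thesis by simp
qed

lemma EU_expand1: "EU u s t = (\<Sum>a\<in>UNIV. s a * EU u (pure a) t)"
  by (simp add: EU_pure_left EU_def[of u s t] sum_distrib_left mult.assoc)

text \<open>The game with the players exchanged has payoffs \<open>transp u2\<close> and
  \<open>transp u1\<close>; results about player 2 are derived from those about player 1 this
  way.\<close>

definition transp :: "('a \<Rightarrow> 'b \<Rightarrow> 'c) \<Rightarrow> 'b \<Rightarrow> 'a \<Rightarrow> 'c" where
  "transp u = (\<lambda>b a. u a b)"

lemma transp_apply [simp]: "transp u b a = u a b"
  by (simp add: transp_def)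

lemma EU_flip [simp]: "EU (transp u) t s = EU u s t"
  unfolding EU_def by (subst sum.swap) (simp add: mult.commute)

lemma EU_expand2: "EU u s t = (\<Sum>b\<in>UNIV. t b * EU u s (pure b))"
  using EU_expand1[of "transp u" t s] by simp

lemma EU_pure_right: "EU u s (pure b) = (\<Sum>a\<in>UNIV. s a * u a b)"
  using EU_pure_left[of "transp u" b s] by simp

lemma EU_pure_pure [simp]: "EU u (pure a) (pure b) = u a b"
proof -
  have "EU u (pure a) (pure b) = (\<Sum>y\<in>UNIV. if y = b then u a y else 0)"
    unfolding EU_pure_left by (rule sum.cong) (auto simp: pure_def)
  then show ?thesis by simp
qed

lemma EU_add: "EU (\<lambda>a b. u a b + c a b) s t = EU u s t + EU c s t"
  unfolding EU_def by (simp add: distrib_left sum.distrib)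

lemma EU_const: "s \<in> simplex \<Longrightarrow> t \<in> simplex \<Longrightarrow> EU (\<lambda>a b. c) s t = c"
  unfolding EU_def
  by (simp add: sum_distrib_right[symmetric] sum_distrib_left[symmetric] simplex_sum)

lemma EU_mono:
  assumes "s \<in> simplex" "t \<in> simplex" "\<And>a b. u a b \<le> v a b"
  shows "EU u s t \<le> EU v s t"
  unfolding EU_def using assms
  by (intro sum_mono mult_left_mono mult_nonneg_nonneg) (auto simp: simplex_nonneg)

section \<open>Averages over probability vectors\<close>

lemma weighted_sum_le:
  fixes s :: "'x::finite \<Rightarrow> real"
  assumes "s \<in> simplex" "\<And>a. f a \<le> c"
  shows "(\<Sum>a\<in>UNIV. s a * f a) \<le> c"
proof -
  have "(\<Sum>a\<in>UNIV. s a * f a) \<le> (\<Sum>a\<in>UNIV. s a * c)"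
    using assms by (intro sum_mono mult_left_mono) (auto simp: simplex_nonneg)
  also have "\<dots> = c"
    using assms(1) by (simp add: sum_distrib_right[symmetric] simplex_sum)
  finally show ?thesis .
qed

text \<open>The shortfalls \<open>s a * (c - f a)\<close> are nonnegative and sum to zero, so each
  of them vanishes.\<close>

lemma weighted_sum_eqD:
  fixes s :: "'x::finite \<Rightarrow> real"
  assumes "s \<in> simplex" "\<And>a. f a \<le> c" "(\<Sum>a\<in>UNIV. s a * f a) = c" "s a \<noteq> 0"
  shows "f a = c"
proof -
  have "(\<Sum>a\<in>UNIV. s a * (c - f a)) = 0"
    using assms(1,3)
    by (simp add: right_diff_distrib sum_subtractf sum_distrib_right[symmetric] simplex_sum)
  moreover have "\<forall>a\<in>UNIV. 0 \<le> s a * (c - f a)"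
    using assms(1,2) by (simp add: simplex_nonneg)
  ultimately have "s a * (c - f a) = 0"
    by (simp add: sum_nonneg_eq_0_iff)
  then show ?thesis using assms(4) by simp
qed

lemma weighted_sum_eqI:
  fixes s :: "'x::finite \<Rightarrow> real"
  assumes "s \<in> simplex" "\<And>a. s a \<noteq> 0 \<Longrightarrow> f a = c"
  shows "(\<Sum>a\<in>UNIV. s a * f a) = c"
proof -
  have "(\<Sum>a\<in>UNIV. s a * f a) = (\<Sum>a\<in>UNIV. s a * c)"
    using assms(2) by (intro sum.cong) auto
  also have "\<dots> = c"
    using assms(1) by (simp add: sum_distrib_right[symmetric] simplex_sum)
  finally show ?thesis .
qed

lemma EU_le1:
  assumes "s \<in> simplex" "\<And>a. EU u (pure a) t \<le> c"
  shows "EU u s t \<le> c"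
  unfolding EU_expand1[of u s] using assms by (rule weighted_sum_le)

lemma EU_le2:
  assumes "t \<in> simplex" "\<And>b. EU u s (pure b) \<le> c"
  shows "EU u s t \<le> c"
  unfolding EU_expand2[of u s t] using assms by (rule weighted_sum_le)

text \<open>Expected payoff is linear in a player's own strategy and every available strategy lies
  in the simplex, so in each regime it suffices to rule out pure deviations.\<close>

lemma NashI:
  assumes "s1 \<in> avail1 r" "s2 \<in> avail2 r"
    and "\<And>a. EU u1 (pure a) s2 \<le> EU u1 s1 s2"
    and "\<And>b. EU u2 s1 (pure b) \<le> EU u2 s1 s2"
  shows "(s1, s2) \<in> Nash r u1 u2"
proof -
  have "EU u1 t s2 \<le> EU u1 s1 s2" if "t \<in> avail1 r" for t
    using avail_in_simplex(1)[OF that] assms(3) by (rule EU_le1)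
  moreover have "EU u2 s1 t \<le> EU u2 s1 s2" if "t \<in> avail2 r" for t
    using avail_in_simplex(2)[OF that] assms(4) by (rule EU_le2)
  ultimately show ?thesis using assms(1,2) by (simp add: Nash_def)
qed

lemma NashD:
  assumes "(s1, s2) \<in> Nash r u1 u2"
  shows "s1 \<in> avail1 r" "s2 \<in> avail2 r"
    and "\<And>t. t \<in> avail1 r \<Longrightarrow> EU u1 t s2 \<le> EU u1 s1 s2"
    and "\<And>t. t \<in> avail2 r \<Longrightarrow> EU u2 s1 t \<le> EU u2 s1 s2"
  using assms by (auto simp: Nash_def)

lemma Nash_add_const_iff:
  "(s1, s2) \<in> Nash r (\<lambda>a b. u1 a b + c) (\<lambda>a b. u2 a b + d) \<longleftrightarrow> (s1, s2) \<in> Nash r u1 u2"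
  unfolding Nash_def EU_add by (auto simp: EU_const avail_in_simplex)

lemma best_resp2_add_const:
  assumes "(s1, s2) \<in> Nash r u1 (\<lambda>a b. u2 a b + d)"
  shows "best_resp2 r u2 s1 s2"
  using assms unfolding best_resp2_def Nash_def EU_add by (auto simp: EU_const avail_in_simplex)

text \<open>In the regime \<open>MP\<close> the players have strategy sets of different kinds, so an
  exchange does not preserve the regime.\<close>

lemma Nash_flip:
  assumes "r \<noteq> MP"
  shows "(t, s) \<in> Nash r (transp u2) (transp u1) \<longleftrightarrow> (s, t) \<in> Nash r u1 u2"
  using assms unfolding Nash_def by (cases r) (auto simp: avail1_def avail2_def)

lemma V_flip:
  assumes "r \<noteq> MP"
  shows "V1 r (transp u2) (transp u1) = V2 r u1 u2"
    and "V2 r (transp u2) (transp u1) = V1 r u1 u2"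
proof -
  have "Nash r (transp u2) (transp u1) = prod.swap ` Nash r u1 u2"
    using Nash_flip[OF assms, of _ _ u2 u1] by force
  then show "V1 r (transp u2) (transp u1) = V2 r u1 u2"
    and "V2 r (transp u2) (transp u1) = V1 r u1 u2"
    unfolding V1_def V2_def by (simp_all add: image_image case_prod_unfold)
qed

lemma best_resp_flip:
  assumes "r \<noteq> MP"
  shows "best_resp2 r (transp u1) t s \<longleftrightarrow> best_resp1 r u1 s t"
    and "best_resp1 r (transp u2) t s \<longleftrightarrow> best_resp2 r u2 s t"
  using assms unfolding best_resp1_def best_resp2_def
  by (cases r; auto simp: avail1_def avail2_def)+

lemma card_trichotomy: "V = {} \<or> card_one V \<or> card_gt1 V"
  unfolding card_one_def card_gt1_def by blast

lemma card_one_not_gt1: "card_one V \<Longrightarrow> \<not> card_gt1 V"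
  unfolding card_one_def card_gt1_def by blast

lemma card_nonempty: "card_one V \<Longrightarrow> V \<noteq> {}" "card_gt1 V \<Longrightarrow> V \<noteq> {}"
  unfolding card_one_def card_gt1_def by auto

lemma V_empty_iff: "V1 r u1 u2 = {} \<longleftrightarrow> Nash r u1 u2 = {}" "V2 r u1 u2 = {} \<longleftrightarrow> Nash r u1 u2 = {}"
  unfolding V1_def V2_def by auto

section \<open>Payoffs in the repeated game\<close>

lemma rep_pay_Suc:
  "rep_pay u m1 m2 (Suc n) h
    = EU (\<lambda>a b. u a b + rep_pay u m1 m2 n (h @ [(a, b)])) (m1 h) (m2 h)"
  by (simp add: EU_def)

lemma rep_pay_cont: "rep_pay u (cont m1 g) (cont m2 g) n h = rep_pay u m1 m2 n (g @ h)"
  by (induction n arbitrary: h) (simp_all add: cont_def)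

text \<open>The recursion only visits histories extending \<open>h\<close>. Hence altering a
  strategy at \<open>[]\<close> leaves all payoffs after the first round unchanged.\<close>

lemma rep_pay_cong_length:
  assumes "\<And>h'. length h \<le> length h' \<Longrightarrow> m1 h' = m1' h'"
    and "\<And>h'. length h \<le> length h' \<Longrightarrow> m2 h' = m2' h'"
  shows "rep_pay u m1 m2 n h = rep_pay u m1' m2' n h"
  using assms
proof (induction n arbitrary: h)
  case (Suc n)
  have "rep_pay u m1 m2 n (h @ [x]) = rep_pay u m1' m2' n (h @ [x])" for x
    by (rule Suc.IH) (auto simp: Suc.prems)
  with Suc.prems show ?case by simp
qed simp

lemma rep_pay_le:
  assumes "\<And>h. m1 h \<in> simplex" "\<And>h. m2 h \<in> simplex"
    and "\<And>h'. length h' < n \<Longrightarrow> EU u (m1 (h @ h')) (m2 (h @ h')) \<le> w (length h')"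
  shows "rep_pay u m1 m2 n h \<le> (\<Sum>k<n. w k)"
  using assms(3)
proof (induction n arbitrary: h w)
  case (Suc n)
  have "rep_pay u m1 m2 n (h @ [x]) \<le> (\<Sum>k<n. w (Suc k))" for x
    using Suc.prems[of "x # h'" for h'] by (intro Suc.IH) auto
  then have "rep_pay u m1 m2 (Suc n) h
      \<le> EU (\<lambda>a b. u a b + (\<Sum>k<n. w (Suc k))) (m1 h) (m2 h)"
    unfolding rep_pay_Suc using assms by (intro EU_mono) auto
  also have "\<dots> = EU u (m1 h) (m2 h) + (\<Sum>k<n. w (Suc k))"
    using assms by (simp add: EU_add EU_const)
  also have "\<dots> \<le> (\<Sum>k<Suc n. w k)"
    using Suc.prems[of "[]"] by (simp add: sum.lessThan_Suc_shift del: sum.lessThan_Suc)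
  finally show ?case .
qed simp

lemma rep_pay_eq:
  assumes "\<And>h. m1 h \<in> simplex" "\<And>h. m2 h \<in> simplex"
    and "\<And>h'. length h' < n \<Longrightarrow> EU u (m1 (h @ h')) (m2 (h @ h')) = w (length h')"
  shows "rep_pay u m1 m2 n h = (\<Sum>k<n. w k)"
  using assms(3)
proof (induction n arbitrary: h w)
  case (Suc n)
  have "rep_pay u m1 m2 n (h @ [x]) = (\<Sum>k<n. w (Suc k))" for x
    using Suc.prems[of "x # h'" for h'] by (intro Suc.IH) auto
  then have "rep_pay u m1 m2 (Suc n) h = EU u (m1 h) (m2 h) + (\<Sum>k<n. w (Suc k))"
    unfolding rep_pay_Suc using assms by (simp add: EU_add EU_const)
  also have "\<dots> = (\<Sum>k<Suc n. w k)"
    using Suc.prems[of "[]"] by (simp add: sum.lessThan_Suc_shift del: sum.lessThan_Suc)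
  finally show ?case .
qed simp

text \<open>Only deviations at the empty history are tested; they keep the continuation payoffs,
  which can therefore be added to the stage payoffs.\<close>

lemma NE_rep_imp_Nash:
  assumes "NE_rep r u1 u2 (Suc n) m1 m2"
  shows "(m1 [], m2 []) \<in> Nash r (\<lambda>a b. u1 a b + rep_pay u1 m1 m2 n [(a, b)])
                                  (\<lambda>a b. u2 a b + rep_pay u2 m1 m2 n [(a, b)])"
proof -
  have s: "strat1 r m1" "strat2 r m2"
    and d1: "\<And>d. strat1 r d \<Longrightarrow> rep_pay u1 d m2 (Suc n) [] \<le> rep_pay u1 m1 m2 (Suc n) []"
    and d2: "\<And>d. strat2 r d \<Longrightarrow> rep_pay u2 m1 d (Suc n) [] \<le> rep_pay u2 m1 m2 (Suc n) []"
    using assms unfolding NE_rep_def by auto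
  have "EU (\<lambda>a b. u1 a b + rep_pay u1 m1 m2 n [(a, b)]) t (m2 [])
      \<le> EU (\<lambda>a b. u1 a b + rep_pay u1 m1 m2 n [(a, b)]) (m1 []) (m2 [])"
    if t: "t \<in> avail1 r" for t
  proof -
    have "rep_pay u1 (m1([] := t)) m2 n [x] = rep_pay u1 m1 m2 n [x]" for x
      by (rule rep_pay_cong_length) auto
    moreover have "strat1 r (m1([] := t))" using s t by (simp add: strat1_def)
    ultimately show ?thesis using d1[of "m1([] := t)"] unfolding rep_pay_Suc by simp
  qed
  moreover have "EU (\<lambda>a b. u2 a b + rep_pay u2 m1 m2 n [(a, b)]) (m1 []) t
      \<le> EU (\<lambda>a b. u2 a b + rep_pay u2 m1 m2 n [(a, b)]) (m1 []) (m2 [])"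
    if t: "t \<in> avail2 r" for t
  proof -
    have "rep_pay u2 m1 (m2([] := t)) n [x] = rep_pay u2 m1 m2 n [x]" for x
      by (rule rep_pay_cong_length) auto
    moreover have "strat2 r (m2([] := t))" using s t by (simp add: strat2_def)
    ultimately show ?thesis using d2[of "m2([] := t)"] unfolding rep_pay_Suc by simp
  qed
  ultimately show ?thesis using s unfolding Nash_def strat1_def strat2_def by blast
qed

section \<open>Necessity\<close>

text \<open>\<open>c1\<close> and \<open>c2\<close> are the continuation payoffs after a longest
  history with a non-equilibrium profile, as functions of the next realized pair.\<close>

lemma in_GLS_imp_perturbed_Nash:
  assumes "in_GLS r u1 u2"
  obtains s1 s2 c1 c2 where "(s1, s2) \<notin> Nash r u1 u2"
    and "(s1, s2) \<in> Nash r (\<lambda>a b. u1 a b + c1 a b) (\<lambda>a b. u2 a b + c2 a b)"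
    and "Nash r u1 u2 \<noteq> {}"
    and "card_one (V1 r u1 u2) \<longrightarrow> (\<exists>c. c1 = (\<lambda>a b. c))"
    and "card_one (V2 r u1 u2) \<longrightarrow> (\<exists>c. c2 = (\<lambda>a b. c))"
proof -
  from assms obtain T m1 m2 h0 where spe: "SPE r u1 u2 T m1 m2"
    and h0: "length h0 < T \<and> (m1 h0, m2 h0) \<notin> Nash r u1 u2"
    unfolding in_GLS_def by blast
  obtain h where h: "length h < T" "(m1 h, m2 h) \<notin> Nash r u1 u2"
    and maxh: "\<And>g. length g < T \<Longrightarrow> (m1 g, m2 g) \<notin> Nash r u1 u2 \<Longrightarrow> length g \<le> length h"
    using ex_has_greatest_nat[of "\<lambda>g. length g < T \<and> (m1 g, m2 g) \<notin> Nash r u1 u2" h0 length T] h0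
    by (metis less_imp_le)
  obtain n where n: "T - length h = Suc n" using h(1) by (metis Suc_diff_Suc)
  define c where "c u a b = rep_pay u m1 m2 n (h @ [(a, b)])"
    for u :: "'a \<Rightarrow> 'b \<Rightarrow> real" and a b
  have av: "m1 g \<in> simplex" "m2 g \<in> simplex" for g
    using spe unfolding SPE_def strat1_def strat2_def by (auto dest: avail_in_simplex)
  have later: "(m1 g, m2 g) \<in> Nash r u1 u2" if "length h < length g" "length g < T" for g
    using maxh[of g] that by auto
  have "NE_rep r u1 u2 (Suc n) (cont m1 h) (cont m2 h)"
    using spe h(1) n unfolding SPE_def by metis
  from NE_rep_imp_Nash[OF this]
  have N: "(m1 h, m2 h) \<in> Nash r (\<lambda>a b. u1 a b + c u1 a b) (\<lambda>a b. u2 a b + c u2 a b)"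
    unfolding rep_pay_cont c_def by (simp add: cont_def)
  \<comment> \<open>In the last round continuation payoffs vanish, so the profile would be a stage
    equilibrium. Thus a later round exists, and the equilibrium played there shows that
    \<open>Nash r u1 u2\<close> is nonempty.\<close>
  have "n \<noteq> 0"
  proof
    assume "n = 0"
    with N h(2) show False using Nash_add_const_iff[of _ _ r u1 0 u2 0] by (simp add: c_def)
  qed
  then have ne: "Nash r u1 u2 \<noteq> {}"
    using later[of "h @ [undefined]"] n by fastforce
  have const: "c u a b = (\<Sum>k<n. v)"
    if "\<And>s t. (s, t) \<in> Nash r u1 u2 \<Longrightarrow> EU u s t = v" for u v a b
    unfolding c_def using av later that n by (intro rep_pay_eq) auto
  have "\<exists>d. c u1 = (\<lambda>a b. d)" if "card_one (V1 r u1 u2)"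
  proof -
    from that obtain v where "V1 r u1 u2 = {v}" unfolding card_one_def by blast
    then have "EU u1 s t = v" if "(s, t) \<in> Nash r u1 u2" for s t
      using that unfolding V1_def by force
    then show ?thesis using const[of u1 v] by (intro exI ext) auto
  qed
  moreover have "\<exists>d. c u2 = (\<lambda>a b. d)" if "card_one (V2 r u1 u2)"
  proof -
    from that obtain v where "V2 r u1 u2 = {v}" unfolding card_one_def by blast
    then have "EU u2 s t = v" if "(s, t) \<in> Nash r u1 u2" for s t
      using that unfolding V2_def by force
    then show ?thesis using const[of u2 v] by (intro exI ext) auto
  qed
  ultimately show thesis using that h(2) N ne by blast
qed

lemma pure_gain1:
  assumes "s1 \<in> avail1 r" "best_resp2 r u2 s1 s2" "(s1, s2) \<notin> Nash r u1 u2"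
  shows "\<exists>a. EU u1 s1 s2 < EU u1 (pure a) s2"
proof (rule ccontr)
  assume "\<not> ?thesis"
  then have "(s1, s2) \<in> Nash r u1 u2"
    using assms(1,2) unfolding best_resp2_def by (intro NashI) (auto simp: not_less)
  with assms(3) show False by simp
qed

text \<open>A constant continuation payoff drops out of the incentives, so a player with a single
  equilibrium payoff best responds in the stage game. If both did, the profile would be an
  equilibrium.\<close>

lemma in_GLS_cases [consumes 2]:
  assumes "in_GLS r u1 u2" "r \<noteq> MP"
  obtains (both) s1 s2 where "card_gt1 (V1 r u1 u2)" "card_gt1 (V2 r u1 u2)"
      "s1 \<in> avail1 r" "s2 \<in> avail2 r" "(s1, s2) \<notin> Nash r u1 u2"
    | (first) s1 s2 a where "card_gt1 (V1 r u1 u2)" "card_one (V2 r u1 u2)"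
      "s1 \<in> avail1 r" "s2 \<in> avail2 r" "best_resp2 r u2 s1 s2" "EU u1 s1 s2 < EU u1 (pure a) s2"
    | (second) s1 s2 b where "card_one (V1 r u1 u2)" "card_gt1 (V2 r u1 u2)"
      "s1 \<in> avail1 r" "s2 \<in> avail2 r" "best_resp1 r u1 s1 s2" "EU u2 s1 s2 < EU u2 s1 (pure b)"
proof -
  obtain s1 s2 c1 c2 where nN: "(s1, s2) \<notin> Nash r u1 u2"
    and N: "(s1, s2) \<in> Nash r (\<lambda>a b. u1 a b + c1 a b) (\<lambda>a b. u2 a b + c2 a b)"
    and ne: "Nash r u1 u2 \<noteq> {}"
    and k1: "card_one (V1 r u1 u2) \<longrightarrow> (\<exists>c. c1 = (\<lambda>a b. c))"
    and k2: "card_one (V2 r u1 u2) \<longrightarrow> (\<exists>c. c2 = (\<lambda>a b. c))"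
    by (rule in_GLS_imp_perturbed_Nash[OF assms(1)])
  have av: "s1 \<in> avail1 r" "s2 \<in> avail2 r" using NashD[OF N] by auto
  have tri: "card_one (V1 r u1 u2) \<or> card_gt1 (V1 r u1 u2)"
    "card_one (V2 r u1 u2) \<or> card_gt1 (V2 r u1 u2)"
    using card_trichotomy ne V_empty_iff by metis+
  have b2: "best_resp2 r u2 s1 s2" if "card_one (V2 r u1 u2)"
    using k2 that N best_resp2_add_const by blast
  have b1: "best_resp1 r u1 s1 s2" if o: "card_one (V1 r u1 u2)"
  proof -
    from N have "(s2, s1) \<in> Nash r (transp (\<lambda>a b. u2 a b + c2 a b)) (transp (\<lambda>a b. u1 a b + c1 a b))"
      using Nash_flip[OF assms(2)] by fast
    with k1 o have "best_resp2 r (transp u1) s2 s1"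
      using best_resp2_add_const[of s2 s1 r _ "transp u1"] by (auto simp: transp_def)
    then show ?thesis using best_resp_flip[OF assms(2)] by blast
  qed
  consider "card_one (V1 r u1 u2)" "card_one (V2 r u1 u2)"
    | "card_gt1 (V1 r u1 u2)" "card_gt1 (V2 r u1 u2)"
    | "card_gt1 (V1 r u1 u2)" "card_one (V2 r u1 u2)"
    | "card_one (V1 r u1 u2)" "card_gt1 (V2 r u1 u2)"
    using tri by blast
  then show thesis
  proof cases
    case 1
    then have "(s1, s2) \<in> Nash r u1 u2"
      using b1 b2 unfolding best_resp1_def best_resp2_def Nash_def by blast
    with nN show thesis by simp
  next
    case 2
    then show thesis using both av nN by blast
  next
    case 3
    then show thesis using first av b2 pure_gain1[OF av(1) b2 nN] by blast
  next
    case 4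
    have "\<exists>b. EU (transp u2) s2 s1 < EU (transp u2) (pure b) s1"
    proof (rule pure_gain1)
      show "s2 \<in> avail1 r" using av(2) assms(2) by (cases r) (auto simp: avail1_def avail2_def)
      show "best_resp2 r (transp u1) s2 s1" using b1[OF 4(1)] best_resp_flip[OF assms(2)] by blast
      show "(s2, s1) \<notin> Nash r (transp u2) (transp u1)" using nN Nash_flip[OF assms(2)] by blast
    qed
    then show thesis using second[OF 4 av b1[OF 4(1)]] by auto
  qed
qed

lemma in_GLS_PP_imp_C_pp:
  assumes "in_GLS PP u1 u2"
  shows "C_pp u1 u2"
proof -
  have p: "s \<in> avail1 PP \<Longrightarrow> \<exists>a. s = pure a" "t \<in> avail2 PP \<Longrightarrow> \<exists>b. t = pure b"
    for s :: "'a \<Rightarrow> real" and t :: "'b \<Rightarrow> real"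
    by (auto simp: avail1_def avail2_def pure_strats_def)
  show ?thesis
    using assms regime.distinct(1)
  proof (cases rule: in_GLS_cases)
    case (both s1 s2)
    then show ?thesis using p unfolding C_pp_def by blast
  next
    case (first s1 s2 a)
    moreover from first p obtain x y where "s1 = pure x" "s2 = pure y" by blast
    ultimately show ?thesis unfolding C_pp_def by auto
  next
    case (second s1 s2 b)
    moreover from second p obtain x y where "s1 = pure x" "s2 = pure y" by blast
    ultimately show ?thesis unfolding C_pp_def by (simp, blast)
  qed
qed

lemma in_GLS_MM_imp_C_mm:
  assumes "in_GLS MM u1 u2"
  shows "C_mm u1 u2"
proof -
  have p: "avail1 MM = simplex" "avail2 MM = simplex" by (auto simp: avail1_def avail2_def)
  show ?thesis
    using assms regime.distinct(6)
  proof (cases rule: in_GLS_cases)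
    case (both s1 s2)
    then show ?thesis unfolding C_mm_def p by blast
  next
    case (first s1 s2 a)
    then show ?thesis unfolding C_mm_def p by blast
  next
    case (second s1 s2 a)
    then show ?thesis unfolding C_mm_def p by blast
  qed
qed

section \<open>Sufficiency\<close>

definition prof_val :: "('a::finite \<Rightarrow> 'b::finite \<Rightarrow> real) \<Rightarrow> ('a \<Rightarrow> real) \<times> ('b \<Rightarrow> real) \<Rightarrow> real" where
  "prof_val u p = EU u (fst p) (snd p)"

lemma V_eq_prof_val:
  "V1 r u1 u2 = prof_val u1 ` Nash r u1 u2" "V2 r u1 u2 = prof_val u2 ` Nash r u1 u2"
  by (auto simp: V1_def V2_def prof_val_def case_prod_unfold)

text \<open>A profile that is not a stage Nash equilibrium becomes an equilibrium of the first round
  once it is followed by \<open>n\<close> rounds of stage equilibria \<open>P (a, b) 0, \<dots>, P (a, b) (n - 1)\<close>, which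
  may depend on the pair \<open>(a, b)\<close> realized in the first round.\<close>
definition enforceable ::
  "regime \<Rightarrow> ('a::finite \<Rightarrow> 'b::finite \<Rightarrow> real) \<Rightarrow> ('a \<Rightarrow> 'b \<Rightarrow> real) \<Rightarrow> bool"
  where "enforceable r u1 u2 \<longleftrightarrow> (\<exists>s1 s2 (n::nat) P. (s1, s2) \<notin> Nash r u1 u2 \<and> (\<forall>x k. P x k \<in> Nash r u1 u2) \<and>
     (s1, s2) \<in> Nash r (\<lambda>a b. u1 a b + (\<Sum>k<n. prof_val u1 (P (a, b) k)))
                       (\<lambda>a b. u2 a b + (\<Sum>k<n. prof_val u2 (P (a, b) k))))"

text \<open>After the first round, play depends only on the first realized pair and the round
  number, so later deviations cannot influence the opponent. First-round deviations are deterred by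
  the augmented stage game.\<close>

lemma enforceable_imp_in_GLS:
  assumes "enforceable r u1 u2"
  shows "in_GLS r u1 u2"
proof -
  obtain s1 s2 P and n :: nat where nN: "(s1, s2) \<notin> Nash r u1 u2" and P: "\<And>x k. P x k \<in> Nash r u1 u2"
    and N: "(s1, s2) \<in> Nash r (\<lambda>a b. u1 a b + (\<Sum>k<n. prof_val u1 (P (a, b) k)))
                              (\<lambda>a b. u2 a b + (\<Sum>k<n. prof_val u2 (P (a, b) k)))"
    using assms unfolding enforceable_def by blast
  \<comment> \<open>After \<open>x # t\<close>, item \<open>length t\<close> of the plan for
    \<open>x\<close> is due; the pairs in \<open>t\<close> are ignored.\<close>
  define m1 where "m1 h = (case h of [] \<Rightarrow> s1 | x # t \<Rightarrow> fst (P x (length t)))" for h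
  define m2 where "m2 h = (case h of [] \<Rightarrow> s2 | x # t \<Rightarrow> snd (P x (length t)))" for h
  have PN: "(fst (P x k), snd (P x k)) \<in> Nash r u1 u2" for x k using P by simp
  have st: "strat1 r m1" "strat2 r m2"
    using NashD(1,2)[OF N] NashD(1,2)[OF PN]
    by (auto simp: strat1_def strat2_def m1_def m2_def split: list.split)
  have sx: "strat1 r d \<Longrightarrow> d h \<in> simplex" "strat2 r e \<Longrightarrow> e h \<in> simplex" for d e h
    by (auto simp: strat1_def strat2_def dest: avail_in_simplex)
  have mx: "m1 h \<in> simplex" "m2 h \<in> simplex" for h
    using sx st by auto
  have mC: "m1 (x # t) = fst (P x (length t))" "m2 (x # t) = snd (P x (length t))" for x t
    by (simp_all add: m1_def m2_def)
  have path: "rep_pay u m1 m2 k (x # t) = (\<Sum>i<k. prof_val u (P x (length t + i)))" for u k x t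
    using mx by (intro rep_pay_eq) (auto simp: mC prof_val_def)
  have dev1: "rep_pay u1 d m2 k (x # t) \<le> rep_pay u1 m1 m2 k (x # t)" if d: "strat1 r d" for d k x t
    unfolding path
  proof (rule rep_pay_le)
    show "EU u1 (d ((x # t) @ h)) (m2 ((x # t) @ h)) \<le> prof_val u1 (P x (length t + length h))" for h
      using NashD(3)[OF PN] d by (simp add: mC prof_val_def strat1_def)
  qed (use sx d mx in auto)
  have dev2: "rep_pay u2 m1 d k (x # t) \<le> rep_pay u2 m1 m2 k (x # t)" if d: "strat2 r d" for d k x t
    unfolding path
  proof (rule rep_pay_le)
    show "EU u2 (m1 ((x # t) @ h)) (d ((x # t) @ h)) \<le> prof_val u2 (P x (length t + length h))" for h
      using NashD(4)[OF PN] d by (simp add: mC prof_val_def strat2_def)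
  qed (use sx d mx in auto)
  have first: "rep_pay u m1 m2 (Suc n) [] = EU (\<lambda>a b. u a b + (\<Sum>k<n. prof_val u (P (a, b) k))) s1 s2"
    for u
    unfolding rep_pay_Suc using path[of u n _ "[]"] by (simp add: m1_def m2_def)
  have fdev1: "rep_pay u1 d m2 (Suc n) [] \<le> rep_pay u1 m1 m2 (Suc n) []" if d: "strat1 r d" for d
  proof -
    have "rep_pay u1 d m2 (Suc n) [] \<le> EU (\<lambda>a b. u1 a b + (\<Sum>k<n. prof_val u1 (P (a, b) k))) (d []) (m2 [])"
      unfolding rep_pay_Suc
      using sx d mx dev1[OF d, of n _ "[]"] path[of u1 n _ "[]"] by (intro EU_mono) auto
    also have "\<dots> \<le> rep_pay u1 m1 m2 (Suc n) []"
      unfolding first using NashD(3)[OF N, of "d []"] d by (simp add: m2_def strat1_def)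
    finally show ?thesis .
  qed
  have fdev2: "rep_pay u2 m1 d (Suc n) [] \<le> rep_pay u2 m1 m2 (Suc n) []" if d: "strat2 r d" for d
  proof -
    have "rep_pay u2 m1 d (Suc n) [] \<le> EU (\<lambda>a b. u2 a b + (\<Sum>k<n. prof_val u2 (P (a, b) k))) (m1 []) (d [])"
      unfolding rep_pay_Suc
      using sx d mx dev2[OF d, of n _ "[]"] path[of u2 n _ "[]"] by (intro EU_mono) auto
    also have "\<dots> \<le> rep_pay u2 m1 m2 (Suc n) []"
      unfolding first using NashD(4)[OF N, of "d []"] d by (simp add: m1_def strat2_def)
    finally show ?thesis .
  qed
  have "NE_rep r u1 u2 (Suc n - length h) (cont m1 h) (cont m2 h)" if "length h < Suc n" for h
  proof -
    define k where "k = Suc n - length h"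
    have sc: "strat1 r (cont m1 h)" "strat2 r (cont m2 h)"
      using st by (auto simp: strat1_def strat2_def cont_def)
    have best: "rep_pay u1 d m2 k h \<le> rep_pay u1 m1 m2 k h" if "strat1 r d" for d
      using dev1[OF that] fdev1[OF that] by (cases h) (auto simp: k_def)
    have best': "rep_pay u2 m1 d k h \<le> rep_pay u2 m1 m2 k h" if "strat2 r d" for d
      using dev2[OF that] fdev2[OF that] by (cases h) (auto simp: k_def)
    \<comment> \<open>A deviation in the continuation after \<open>h\<close> is lifted to the whole
      game by deleting the first \<open>length h\<close> entries; \<open>cont\<close> undoes the
      lift.\<close>
    have ext: "cont (\<lambda>g. d (drop (length h) g)) h = d" for d :: "('a \<times> 'b) list \<Rightarrow> 'z"
      by (simp add: cont_def)
    have "rep_pay u1 d (cont m2 h) k [] \<le> rep_pay u1 (cont m1 h) (cont m2 h) k []"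
      if "strat1 r d" for d
    proof -
      have "strat1 r (\<lambda>g. d (drop (length h) g))" using that by (simp add: strat1_def)
      from best[OF this] show ?thesis
        using rep_pay_cont[of u1 "\<lambda>g. d (drop (length h) g)" h m2 k "[]"]
          rep_pay_cont[of u1 m1 h m2 k "[]"] by (simp add: ext)
    qed
    moreover have "rep_pay u2 (cont m1 h) d k [] \<le> rep_pay u2 (cont m1 h) (cont m2 h) k []"
      if "strat2 r d" for d
    proof -
      have "strat2 r (\<lambda>g. d (drop (length h) g))" using that by (simp add: strat2_def)
      from best'[OF this] show ?thesis
        using rep_pay_cont[of u2 m1 h "\<lambda>g. d (drop (length h) g)" k "[]"]
          rep_pay_cont[of u2 m1 h m2 k "[]"] by (simp add: ext)
    qed
    ultimately show ?thesis using sc unfolding NE_rep_def k_def by blast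
  qed
  then have "SPE r u1 u2 (Suc n) m1 m2" using st unfolding SPE_def by blast
  moreover have "(m1 [], m2 []) \<notin> Nash r u1 u2" using nN by (simp add: m1_def m2_def)
  ultimately show ?thesis unfolding in_GLS_def by (intro exI[of _ "Suc n"]) force
qed

lemma enforceable_flip:
  assumes "enforceable r (transp u2) (transp u1)" "r \<noteq> MP"
  shows "enforceable r u1 u2"
proof -
  obtain t s P and n :: nat where nN: "(t, s) \<notin> Nash r (transp u2) (transp u1)"
    and P: "\<And>x k. P x k \<in> Nash r (transp u2) (transp u1)"
    and N: "(t, s) \<in> Nash r (\<lambda>b a. transp u2 b a + (\<Sum>k<n. prof_val (transp u2) (P (b, a) k)))
                            (\<lambda>b a. transp u1 b a + (\<Sum>k<n. prof_val (transp u1) (P (b, a) k)))"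
    using assms unfolding enforceable_def by blast
  define Q where "Q x k = prod.swap (P (prod.swap x) k)" for x k
  have Q: "Q x k \<in> Nash r u1 u2" for x k
    using P[of "prod.swap x" k] Nash_flip[OF assms(2)] unfolding Q_def
    by (metis prod.swap_def prod.collapse)
  have pv: "prof_val (transp u) (P (b, a) k) = prof_val u (Q (a, b) k)" for u a b k
    by (simp add: Q_def prof_val_def)
  have tr: "transp (\<lambda>a b. u a b + (\<Sum>k<n. prof_val u (Q (a, b) k)))
      = (\<lambda>b a. transp u b a + (\<Sum>k<n. prof_val (transp u) (P (b, a) k)))" for u
    unfolding pv by (simp add: fun_eq_iff)
  from N have "(t, s) \<in> Nash r (transp (\<lambda>a b. u2 a b + (\<Sum>k<n. prof_val u2 (Q (a, b) k))))
                               (transp (\<lambda>a b. u1 a b + (\<Sum>k<n. prof_val u1 (Q (a, b) k))))"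
    unfolding tr .
  then have "(s, t) \<in> Nash r (\<lambda>a b. u1 a b + (\<Sum>k<n. prof_val u1 (Q (a, b) k)))
                             (\<lambda>a b. u2 a b + (\<Sum>k<n. prof_val u2 (Q (a, b) k)))"
    by (simp only: Nash_flip[OF assms(2)])
  moreover have "(s, t) \<notin> Nash r u1 u2" using nN Nash_flip[OF assms(2)] by blast
  ultimately show ?thesis using Q unfolding enforceable_def by blast
qed

section \<open>Enforcing profiles by rewards and punishments\<close>

lemma finite_bound: "\<exists>M. \<forall>a::'x::finite. f a \<le> (M::real)"
  by (intro exI[of _ "Max (range f)"]) simp

lemma card_gt1_less:
  assumes "card_gt1 (f ` A)"
  obtains x y where "x \<in> A" "y \<in> A" "f x < (f y :: real)"
  using assms unfolding card_gt1_def by (metis imageE linorder_less_linear)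

text \<open>Two equilibria \<open>X, Y\<close> separating player 1 and two equilibria \<open>Z, W\<close> separating player 2 suffice:
  alternating between \<open>Y\<close> and \<open>W\<close> is better for each player than the worst of the three relevant
  equilibria.\<close>
lemma enforceable_both:
  assumes "card_gt1 (V1 r u1 u2)" "card_gt1 (V2 r u1 u2)" "(pure a1, pure a2) \<notin> Nash r u1 u2"
  shows "enforceable r u1 u2"
proof -
  obtain X Y where XY: "X \<in> Nash r u1 u2" "Y \<in> Nash r u1 u2" "prof_val u1 X < prof_val u1 Y"
    using card_gt1_less assms(1) unfolding V_eq_prof_val by blast
  obtain Z W where ZW: "Z \<in> Nash r u1 u2" "W \<in> Nash r u1 u2" "prof_val u2 Z < prof_val u2 W"
    using card_gt1_less assms(2) unfolding V_eq_prof_val by blast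
  \<comment> \<open>\<open>L1\<close> punishes player 1: if \<open>W\<close> is worse for him than
    \<open>X\<close>, it is also worse than \<open>Y\<close>, so either choice of \<open>L1\<close>
    lies below the average of \<open>Y\<close> and \<open>W\<close>. \<open>L2\<close> does the same
    for player 2.\<close>
  define L1 where "L1 = (if prof_val u1 X \<le> prof_val u1 W then X else W)"
  define L2 where "L2 = (if prof_val u2 Z \<le> prof_val u2 Y then Z else Y)"
  define d1 where "d1 = prof_val u1 Y + prof_val u1 W - 2 * prof_val u1 L1"
  define d2 where "d2 = prof_val u2 Y + prof_val u2 W - 2 * prof_val u2 L2"
  have d: "d1 > 0" "d2 > 0" using XY ZW by (auto simp: d1_def d2_def L1_def L2_def)
  obtain M1 where M1: "\<And>a. u1 a a2 - u1 a1 a2 \<le> M1"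
    using finite_bound[of "\<lambda>a. u1 a a2 - u1 a1 a2"] by blast
  obtain M2 where M2: "\<And>b. u2 a1 b - u2 a1 a2 \<le> M2"
    using finite_bound[of "\<lambda>b. u2 a1 b - u2 a1 a2"] by blast
  obtain N1 where N1: "M1 < of_nat N1 * d1" using ex_less_of_nat_mult[OF d(1)] by blast
  obtain N2 where N2: "M2 < of_nat N2 * d2" using ex_less_of_nat_mult[OF d(2)] by blast
  define N where "N = N1 + N2"
  have N: "M1 < of_nat N * d1" "M2 < of_nat N * d2"
    using N1 N2 d by (auto simp: N_def distrib_right intro: less_le_trans)
  define P where "P x k = (if fst x = a1 then if snd x = a2 then if even k then Y else W else L2
      else L1)" for x and k :: nat
  have P: "P x k \<in> Nash r u1 u2" for x k
    using XY ZW by (simp add: P_def L1_def L2_def)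
  \<comment> \<open>An even horizon completes \<open>N\<close> cycles of \<open>Y\<close> and
    \<open>W\<close>; compared with two rounds of punishment, each cycle is worth \<open>d1\<close>
    more to player 1 and \<open>d2\<close> more to player 2.\<close>
  define n where "n = 2 * N"
  then have rn: "real n = 2 * real N" by simp
  have alt: "(\<Sum>k<n. prof_val u (if even k then Y else W)) = of_nat N * (prof_val u Y + prof_val u W)"
    for u unfolding n_def by (induction N) (auto simp: algebra_simps)
  have "(pure a1, pure a2) \<in> Nash r (\<lambda>a b. u1 a b + (\<Sum>k<n. prof_val u1 (P (a, b) k)))
                                   (\<lambda>a b. u2 a b + (\<Sum>k<n. prof_val u2 (P (a, b) k)))"
  proof (rule NashI; (simp only: EU_pure_pure)?)
    fix a
    show "u1 a a2 + (\<Sum>k<n. prof_val u1 (P (a, a2) k))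
        \<le> u1 a1 a2 + (\<Sum>k<n. prof_val u1 (P (a1, a2) k))"
    proof (cases "a = a1")
      case False
      then show ?thesis using M1[of a] N(1) by (simp add: P_def alt rn d1_def algebra_simps)
    qed simp
  next
    fix b
    show "u2 a1 b + (\<Sum>k<n. prof_val u2 (P (a1, b) k))
        \<le> u2 a1 a2 + (\<Sum>k<n. prof_val u2 (P (a1, a2) k))"
    proof (cases "b = a2")
      case False
      then show ?thesis using M2[of b] N(2) by (simp add: P_def alt rn d2_def algebra_simps)
    qed simp
  qed auto
  then show ?thesis using P assms(3) unfolding enforceable_def by blast
qed

text \<open>Here only player 1 has to be given incentives, so the continuation depends on his action alone;
  player 2 gets the same continuation payoff after every history.\<close>
lemma enforceable_first:
  assumes "card_one (V2 r u1 u2)" "s1 \<in> avail1 r" "best_resp2 r u2 s1 s2" "(s1, s2) \<notin> Nash r u1 u2"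
    and Q: "\<And>a. Q a \<in> Nash r u1 u2"
    and le: "\<And>a. EU u1 (pure a) s2 + of_nat n * prof_val u1 (Q a) \<le> K"
    and eq: "\<And>a. s1 a \<noteq> 0 \<Longrightarrow> EU u1 (pure a) s2 + of_nat n * prof_val u1 (Q a) = K"
  shows "enforceable r u1 u2"
proof -
  define P where "P x (k::nat) = Q (fst x)" for x :: "'a \<times> 'b" and k
  obtain v where v: "V2 r u1 u2 = {v}" using assms(1) unfolding card_one_def by blast
  have PQ: "prof_val u2 (Q a) = v" for a using v Q unfolding V_eq_prof_val by blast
  have s2: "s2 \<in> avail2 r" using assms(3) by (simp add: best_resp2_def)
  have sx: "s1 \<in> simplex" "s2 \<in> simplex" using assms(2) s2 by (auto dest: avail_in_simplex)
  let ?u = "\<lambda>a b. u1 a b + (\<Sum>k<n. prof_val u1 (P (a, b) k))"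
  have p: "EU ?u (pure a) s2 = EU u1 (pure a) s2 + of_nat n * prof_val u1 (Q a)" for a
    unfolding EU_add using sx
    by (simp add: P_def EU_pure_left[of "\<lambda>a b. of_nat n * prof_val u1 (Q a)"]
        sum_distrib_right[symmetric] simplex_sum)
  have val: "EU ?u s1 s2 = K"
    unfolding EU_expand1[of ?u s1] p using sx eq by (intro weighted_sum_eqI) auto
  have "(s1, s2) \<in> Nash r ?u (\<lambda>a b. u2 a b + (\<Sum>k<n. prof_val u2 (P (a, b) k)))"
  proof (rule NashI)
    show "EU ?u (pure a) s2 \<le> EU ?u s1 s2" for a
      unfolding val p by (rule le)
    show "EU (\<lambda>a b. u2 a b + (\<Sum>k<n. prof_val u2 (P (a, b) k))) s1 (pure b)
        \<le> EU (\<lambda>a b. u2 a b + (\<Sum>k<n. prof_val u2 (P (a, b) k))) s1 s2" for b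
      unfolding P_def PQ EU_add using assms(3) sx
      by (simp add: EU_const best_resp2_def)
  qed (use assms(2) s2 in auto)
  moreover have "\<And>x k. P x k \<in> Nash r u1 u2" using Q by (simp add: P_def)
  ultimately show ?thesis using assms(4) unfolding enforceable_def by blast
qed

text \<open>Equal stage payoffs on the support permit one common reward \<open>Y\<close>; all other
  actions are followed by \<open>X\<close>, for enough rounds to outweigh any stage gain.\<close>

lemma enforceable_if_indifferent_on_support:
  assumes "card_gt1 (V1 r u1 u2)" "card_one (V2 r u1 u2)"
    and "s1 \<in> avail1 r" "best_resp2 r u2 s1 s2" "(s1, s2) \<notin> Nash r u1 u2"
    and eq: "\<And>a. s1 a \<noteq> 0 \<Longrightarrow> EU u1 (pure a) s2 = c"
  shows "enforceable r u1 u2"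
proof -
  obtain X Y where XY: "X \<in> Nash r u1 u2" "Y \<in> Nash r u1 u2" "prof_val u1 X < prof_val u1 Y"
    using card_gt1_less assms(1) unfolding V_eq_prof_val by blast
  obtain M where M: "\<And>a. EU u1 (pure a) s2 - c \<le> M"
    using finite_bound[of "\<lambda>a. EU u1 (pure a) s2 - c"] by blast
  obtain n where n: "M < of_nat n * (prof_val u1 Y - prof_val u1 X)"
    using ex_less_of_nat_mult[of "prof_val u1 Y - prof_val u1 X"] XY(3) by auto
  show ?thesis
  proof (rule enforceable_first[OF assms(2-5), where Q = "\<lambda>a. if s1 a = 0 then X else Y" and n = n])
    show "EU u1 (pure a) s2 + of_nat n * prof_val u1 (if s1 a = 0 then X else Y)
        \<le> c + of_nat n * prof_val u1 Y" for a
      using eq[of a] M[of a] n by (auto simp: algebra_simps)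
  qed (use XY eq in auto)
qed

text \<open>With a whole interval of equilibrium payoffs, player 1 can be made exactly indifferent between
  all his actions in the first round.\<close>
lemma enforceable_if_interval:
  assumes "card_one (V2 r u1 u2)"
    and "s1 \<in> avail1 r" "best_resp2 r u2 s1 s2" "(s1, s2) \<notin> Nash r u1 u2"
    and "x < y" and int: "\<And>z. x \<le> z \<Longrightarrow> z \<le> y \<Longrightarrow> \<exists>p\<in>Nash r u1 u2. prof_val u1 p = z"
  shows "enforceable r u1 u2"
proof -
  define f where "f a = EU u1 (pure a) s2" for a
  obtain F where F: "\<And>a. f a \<le> F" using finite_bound[of f] by blast
  obtain M where M: "\<And>a. F - f a \<le> M" using finite_bound[of "\<lambda>a. F - f a"] by blast
  obtain n where n: "M < of_nat n * (y - x)" using ex_less_of_nat_mult[of "y - x"] assms(5) by auto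
  have "0 \<le> M" using F M order_trans[of 0 "F - f undefined" M] by auto
  with n have npos: "n > 0" by (cases n) auto
  \<comment> \<open>Over \<open>n\<close> rounds this value repays the shortfall of action
    \<open>a\<close> from the bound \<open>F\<close>; a large \<open>n\<close> keeps it inside the
    interval.\<close>
  have "\<exists>p\<in>Nash r u1 u2. prof_val u1 p = x + (F - f a) / of_nat n" for a
  proof (rule int)
    show "x \<le> x + (F - f a) / of_nat n" using F by simp
    have "(F - f a) / of_nat n \<le> y - x"
      using M[of a] n npos by (simp add: divide_le_eq mult.commute)
    then show "x + (F - f a) / of_nat n \<le> y" by simp
  qed
  then obtain Q where Q: "\<And>a. Q a \<in> Nash r u1 u2"
    "\<And>a. prof_val u1 (Q a) = x + (F - f a) / of_nat n" by metis
  have "EU u1 (pure a) s2 + of_nat n * prof_val u1 (Q a) = F + of_nat n * x" for a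
    using npos by (simp add: Q(2) f_def[symmetric] distrib_left)
  then show ?thesis
    using enforceable_first[where Q = Q and n = n and K = "F + of_nat n * x", OF assms(1-4) Q(1)] by simp
qed

section \<open>Mixtures of two actions and indifference along a segment\<close>

definition mix :: "real \<Rightarrow> 'x \<Rightarrow> 'x \<Rightarrow> 'x \<Rightarrow> real" where
  "mix p x y = (\<lambda>z. (1 - p) * pure x z + p * pure y z)"

lemma mix_in_simplex:
  "0 \<le> p \<Longrightarrow> p \<le> 1 \<Longrightarrow> mix p (x::'x::finite) y \<in> simplex"
  using simplex_sum[OF pure_in_simplex[of x]] simplex_sum[OF pure_in_simplex[of y]]
  by (auto simp: simplex_def mix_def sum.distrib sum_distrib_left[symmetric] pure_apply)

lemma EU_mix_left: "EU u (mix p x y) t = (1 - p) * EU u (pure x) t + p * EU u (pure y) t"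
  unfolding EU_def mix_def
  by (simp add: distrib_right sum.distrib sum_distrib_left mult.assoc)

lemma EU_mix_right: "EU u s (mix p x y) = (1 - p) * EU u s (pure x) + p * EU u s (pure y)"
  using EU_mix_left[of "transp u" p x y s] by simp

lemma mix_support: "mix p x y z \<noteq> 0 \<Longrightarrow> z = x \<or> z = y"
  by (auto simp: mix_def pure_def split: if_splits)

lemma best_resp2_MM_iff:
  "best_resp2 MM u2 s t \<longleftrightarrow> t \<in> simplex \<and> (\<forall>b. EU u2 s (pure b) \<le> EU u2 s t)"
proof
  assume "best_resp2 MM u2 s t"
  then show "t \<in> simplex \<and> (\<forall>b. EU u2 s (pure b) \<le> EU u2 s t)"
    using pure_in_avail(2)[where r = MM]
    unfolding best_resp2_def by (auto dest: avail_in_simplex)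
next
  assume "t \<in> simplex \<and> (\<forall>b. EU u2 s (pure b) \<le> EU u2 s t)"
  then show "best_resp2 MM u2 s t"
    unfolding best_resp2_def avail2_def by (auto intro: EU_le2)
qed

lemma finite_argmax: "\<exists>b::'x::finite. \<forall>b'. f b' \<le> (f b :: real)"
proof -
  have "Max (range f) \<in> range f" by (rule Max_in) auto
  then obtain b where "Max (range f) = f b" by (rule imageE)
  then show ?thesis using Max_ge[of "range f"] by (intro exI[of _ b]) auto
qed

text \<open>Finitely many strict inequalities at \<open>p = 0\<close> survive for small
  \<open>p > 0\<close>, so a maximizer of the slightly perturbed function already maximizes
  \<open>f\<close>.\<close>

lemma argmax_persists:
  fixes f g :: "'x::finite \<Rightarrow> real"
  shows "\<exists>p b. 0 < p \<and> p < 1 \<and> (\<forall>b'. f b' \<le> f b) \<and>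
    (\<forall>b'. (1 - p) * f b' + p * g b' \<le> (1 - p) * f b + p * g b)"
proof -
  have "\<forall>\<^sub>F p in at_right 0. \<exists>b'. (1 - p) * f b + p * g b < (1 - p) * f b' + p * g b'"
    if "f b < f b'" for b b'
  proof -
    have "((\<lambda>p. (1 - p) * f b' + p * g b' - ((1 - p) * f b + p * g b)) \<longlongrightarrow>
        (1 - 0) * f b' + 0 * g b' - ((1 - 0) * f b + 0 * g b)) (at_right 0)"
      by (intro tendsto_intros)
    then have "\<forall>\<^sub>F p in at_right 0. 0 < (1 - p) * f b' + p * g b' - ((1 - p) * f b + p * g b)"
      using that by (intro order_tendstoD) auto
    then show ?thesis by eventually_elim (auto intro: exI[of _ b'])
  qed
  then have "\<forall>\<^sub>F p in at_right 0. (\<exists>b'. f b < f b') \<longrightarrow>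
      (\<exists>b'. (1 - p) * f b + p * g b < (1 - p) * f b' + p * g b')" for b
    by (cases "\<exists>b'. f b < f b'") auto
  then have "\<forall>\<^sub>F p in at_right 0. \<forall>b. (\<exists>b'. f b < f b') \<longrightarrow>
      (\<exists>b'. (1 - p) * f b + p * g b < (1 - p) * f b' + p * g b')"
    by (rule eventually_all_finite)
  moreover have "\<forall>\<^sub>F p in at_right (0::real). p \<in> {0<..<1}"
    by (rule eventually_at_right_real) simp
  ultimately have "\<forall>\<^sub>F p in at_right 0. p \<in> {0<..<1} \<and> (\<forall>b. (\<exists>b'. f b < f b') \<longrightarrow>
      (\<exists>b'. (1 - p) * f b + p * g b < (1 - p) * f b' + p * g b'))"
    by eventually_elim blast
  then have "\<exists>p. p \<in> {0<..<1} \<and> (\<forall>b. (\<exists>b'. f b < f b') \<longrightarrow>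
      (\<exists>b'. (1 - p) * f b + p * g b < (1 - p) * f b' + p * g b'))"
    by (rule eventually_happens'[rotated]) simp
  then obtain p where p: "p \<in> {0<..<1}" "\<And>b. (\<exists>b'. f b < f b') \<Longrightarrow>
      (\<exists>b'. (1 - p) * f b + p * g b < (1 - p) * f b' + p * g b')"
    by auto
  obtain b where b: "\<And>b'. (1 - p) * f b' + p * g b' \<le> (1 - p) * f b + p * g b"
    using finite_argmax[of "\<lambda>b. (1 - p) * f b + p * g b"] by blast
  then have "\<forall>b'. f b' \<le> f b" using p(2)[of b] by (meson not_less)
  then show ?thesis using p(1) b by auto
qed

text \<open>Intermediate value argument along the segment from \<open>a\<close> to \<open>a'\<close>: the points with a pure best
  response favouring \<open>a\<close> and those with one favouring \<open>a'\<close> form two closed sets that cover the open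
  segment and both meet it.\<close>
lemma indifference_on_segment:
  fixes u1 u2 :: "'a::finite \<Rightarrow> 'b::finite \<Rightarrow> real"
  assumes "\<And>b. (\<forall>b'. u2 a b' \<le> u2 a b) \<Longrightarrow> u1 a' b \<le> u1 a b"
    and "\<And>b. (\<forall>b'. u2 a' b' \<le> u2 a' b) \<Longrightarrow> u1 a b \<le> u1 a' b"
  obtains p t where "0 < p" "p < 1" "best_resp2 MM u2 (mix p a a') t"
    "EU u1 (pure a) t = EU u1 (pure a') t"
proof -
  define U where "U p b = (1 - p) * u2 a b + p * u2 a' b" for p b
  define R where "R b = {p. \<forall>b'. U p b' \<le> U p b}" for b
  define d where "d b = u1 a b - u1 a' b" for b
  define C where "C = (\<Union>b\<in>{b. 0 \<le> d b}. R b)"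
  define D where "D = (\<Union>b\<in>{b. d b \<le> 0}. R b)"
  have cR: "closed (R b)" for b
    unfolding R_def U_def
    by (intro closed_Collect_all closed_Collect_le continuous_intros)
  have cl: "closed C" "closed D" unfolding C_def D_def using cR by (auto intro: closed_UN)
  have cover: "{0<..<1} \<subseteq> C \<union> D"
  proof
    fix p :: real
    obtain b where "p \<in> R b" using finite_argmax[of "U p"] unfolding R_def by blast
    then show "p \<in> C \<union> D" unfolding C_def D_def by (cases "0 \<le> d b") auto
  qed
  have "{0<..<1} \<inter> C \<noteq> {}"
  proof -
    obtain p b where "0 < p" "p < 1" "\<forall>b'. u2 a b' \<le> u2 a b" "\<forall>b'. U p b' \<le> U p b"
      using argmax_persists[of "u2 a" "u2 a'"] unfolding U_def by blast
    then show ?thesis using assms(1)[of b] unfolding C_def R_def d_def by force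
  qed
  \<comment> \<open>The same argument from the other endpoint, where the parameter becomes
    \<open>1 - p\<close>.\<close>
  moreover have "{0<..<1} \<inter> D \<noteq> {}"
  proof -
    obtain p b where "0 < p" "p < 1" "\<forall>b'. u2 a' b' \<le> u2 a' b"
      "\<forall>b'. (1 - p) * u2 a' b' + p * u2 a b' \<le> (1 - p) * u2 a' b + p * u2 a b"
      using argmax_persists[of "u2 a'" "u2 a"] by blast
    then have "1 - p \<in> {0<..<1}" "1 - p \<in> R b" "d b \<le> 0"
      using assms(2)[of b] unfolding R_def d_def U_def by (auto simp: add.commute)
    then show ?thesis unfolding D_def by blast
  qed
  ultimately have "{0<..<1} \<inter> C \<inter> D \<noteq> {}"
    using connected_closedD[OF connected_Ioo[of 0 "1::real"] _ cover cl] by blast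
  then obtain p b b' where p: "0 < p" "p < 1" and b: "p \<in> R b" "0 \<le> d b"
    and b': "p \<in> R b'" "d b' \<le> 0"
    unfolding C_def D_def by auto
  \<comment> \<open>This weight cancels the opposite differences \<open>d b\<close> and
    \<open>d b'\<close>; the separate case covers both being zero.\<close>
  define q where "q = (if d b = 0 then 0 else d b / (d b - d b'))"
  have q: "0 \<le> q" "q \<le> 1" "(1 - q) * d b + q * d b' = 0"
    using b(2) b'(2) by (auto simp: q_def field_simps)
  define t where "t = mix q b b'"
  have E: "EU u2 (mix p a a') (pure y) = U p y" for y by (simp add: EU_mix_left U_def)
  have "U p b = U p b'" using b(1) b'(1) unfolding R_def by (auto intro: antisym)
  then have "EU u2 (mix p a a') t = U p b"
    unfolding t_def EU_mix_right E by (simp add: algebra_simps)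
  then have "best_resp2 MM u2 (mix p a a') t"
    using b(1) mix_in_simplex[OF q(1,2), of b b'] unfolding best_resp2_MM_iff E R_def t_def by simp
  moreover have "EU u1 (pure a) t = EU u1 (pure a') t"
    using q(3) unfolding t_def EU_mix_right d_def by (simp add: algebra_simps)
  ultimately show thesis using that p by blast
qed

lemma EU_eq_maxD:
  assumes "s \<in> simplex" "t \<in> simplex" "\<And>a b. u a b \<le> v" "EU u s t = v" "s a \<noteq> 0" "t b \<noteq> 0"
  shows "u a b = v"
proof -
  have le: "EU u (pure a) t \<le> v" for a
    using assms(2) by (rule EU_le2) (simp add: assms(3))
  have "(\<Sum>a\<in>UNIV. s a * EU u (pure a) t) = v"
    using EU_expand1[of u s t] assms(4) by simp
  from weighted_sum_eqD[OF assms(1) le this assms(5)] have "EU u (pure a) t = v" .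
  then show ?thesis
    using weighted_sum_eqD[OF assms(2), of "u a" v b] assms(3,6) by (simp add: EU_pure_left)
qed

text \<open>The enforced profile depends on the case: a pure pair, \<open>(s1, s2)\<close> itself,
  or a mixture of two actions of player 1 with a reply that makes him indifferent between
  them.\<close>

lemma enforceable_MM_first:
  fixes u1 u2 :: "'a::finite \<Rightarrow> 'b::finite \<Rightarrow> real"
  assumes gt: "card_gt1 (V1 MM u1 u2)" and one: "card_one (V2 MM u1 u2)"
    and s: "s1 \<in> simplex" "best_resp2 MM u2 s1 s2" "EU u1 s1 s2 < EU u1 (pure a0) s2"
  shows "enforceable MM u1 u2"
proof -
  have av: "avail1 MM = simplex" "avail2 MM = simplex" by (auto simp: avail1_def avail2_def)
  have nN: "(s1, s2) \<notin> Nash MM u1 u2" using s(3) NashD(3)[of s1 s2 MM u1 u2 "pure a0"] by auto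
  obtain v where v: "V2 MM u1 u2 = {v}" using one unfolding card_one_def by blast
  have valv: "EU u2 x y = v" if "(x, y) \<in> Nash MM u1 u2" for x y
    using v that unfolding V2_def by force
  have br: "best_resp2 MM u2 (pure a) (pure b) \<longleftrightarrow> (\<forall>b'. u2 a b' \<le> u2 a b)" for a b
    unfolding best_resp2_MM_iff by simp
  show ?thesis
  proof (cases "\<exists>a b. (\<forall>b'. u2 a b' \<le> u2 a b) \<and> (pure a, pure b) \<notin> Nash MM u1 u2")
    case True
    then obtain a b where "best_resp2 MM u2 (pure a) (pure b)" "(pure a, pure b) \<notin> Nash MM u1 u2"
      unfolding br by blast
    then show ?thesis
      by (intro enforceable_if_indifferent_on_support[OF gt one, of "pure a" "pure b" "u1 a b"])
        (auto simp: pure_apply split: if_splits)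
  next
    case False
    then have PN: "(pure a, pure b) \<in> Nash MM u1 u2" if "\<forall>b'. u2 a b' \<le> u2 a b" for a b
      using that by blast
    \<comment> \<open>Each action of player 1 now forms an equilibrium with each of its pure best
      replies, so best replies always pay player 2 exactly \<open>v\<close>, which is thus the
      maximum of \<open>u2\<close>.\<close>
    have eqv: "u2 a b = v" if "\<forall>b'. u2 a b' \<le> u2 a b" for a b
      using valv[OF PN[OF that]] by simp
    have lev: "u2 a b \<le> v" for a b
      using finite_argmax[of "u2 a"] eqv by metis
    have max_iff: "(\<forall>b'. u2 a b' \<le> u2 a b) \<longleftrightarrow> u2 a b = v" for a b
      using eqv lev by auto
    have u1max: "u1 x b \<le> u1 a b" if "u2 a b = v" for a b x
      using NashD(3)[OF PN, of a b "pure x"] that max_iff[of a b] by simp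
    have ex: "\<exists>b. u2 a b = v" for a using finite_argmax[of "u2 a"] max_iff by blast
    show ?thesis
    proof (cases "\<exists>a b b'. u2 a b = v \<and> u2 a b' = v \<and> u1 a b < u1 a b'")
      case True
      then obtain a b b' where b: "u2 a b = v" "u2 a b' = v" "u1 a b < u1 a b'" by blast
      show ?thesis
      \<comment> \<open>Mixtures of \<open>b\<close> and \<open>b'\<close> sweep the interval. With
        \<open>a\<close> they are equilibria, since both are best replies to \<open>a\<close> and
        \<open>a\<close> is optimal against both.\<close>
      proof (rule enforceable_if_interval[OF one _ s(2) nN b(3)])
        fix z assume z: "u1 a b \<le> z" "z \<le> u1 a b'"
        define q where "q = (z - u1 a b) / (u1 a b' - u1 a b)"
        have q: "0 \<le> q" "q \<le> 1" using z b(3) by (auto simp: q_def divide_le_eq)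
        have "(1 - q) * u1 a b + q * u1 a b' = u1 a b + q * (u1 a b' - u1 a b)"
          by (simp add: algebra_simps)
        also have "\<dots> = z" using b(3) by (simp add: q_def)
        finally have qz: "(1 - q) * u1 a b + q * u1 a b' = z" .
        have "(pure a, mix q b b') \<in> Nash MM u1 u2"
        proof (rule NashI)
          show "mix q b b' \<in> avail2 MM" using mix_in_simplex[OF q] by (simp add: av)
          show "EU u1 (pure x) (mix q b b') \<le> EU u1 (pure a) (mix q b b')" for x
            unfolding EU_mix_right using u1max[OF b(1)] u1max[OF b(2)] q
            by (auto intro!: add_mono mult_left_mono)
          show "EU u2 (pure a) (pure y) \<le> EU u2 (pure a) (mix q b b')" for y
            unfolding EU_mix_right using lev[of a y] b by (simp add: algebra_simps)
        qed simp
        moreover have "prof_val u1 (pure a, mix q b b') = z"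
          by (simp add: prof_val_def EU_mix_right qz)
        ultimately show "\<exists>p\<in>Nash MM u1 u2. prof_val u1 p = z" by blast
      qed (simp add: av s(1))
    next
      case False
      then have const: "u1 a b = u1 a b'" if "u2 a b = v" "u2 a b' = v" for a b b'
        using that False by (metis linorder_less_linear)
      obtain \<beta> where \<beta>: "\<And>a. u2 a (\<beta> a) = v" using ex by metis
      \<comment> \<open>Player 1's payoff from \<open>a\<close> against any pure best reply; by
        \<open>const\<close> the choice of \<open>\<beta>\<close> is immaterial.\<close>
      define w where "w a = u1 a (\<beta> a)" for a
      have w: "u1 a b = w a" if "u2 a b = v" for a b
        unfolding w_def using that \<beta> by (rule const)
      \<comment> \<open>Every equilibrium pays player 2 the maximum \<open>v\<close>, so all pairs
        in its support have \<open>u2 a b = v\<close> and pay player 1 \<open>w a\<close>. A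
        constant \<open>w\<close> would leave him a single equilibrium payoff.\<close>
      have "\<exists>a a'. w a \<noteq> w a'"
      proof (rule ccontr)
        assume "\<not> ?thesis"
        then obtain c where c: "\<And>a. w a = c" by metis
        have "EU u1 x y = c" if N: "(x, y) \<in> Nash MM u1 u2" for x y
        proof -
          have xy: "x \<in> simplex" "y \<in> simplex" using NashD(1,2)[OF N] by (auto simp: av)
          have "u1 a b = c" if "x a \<noteq> 0" "y b \<noteq> 0" for a b
            using EU_eq_maxD[OF xy, of u2 v a b] lev valv[OF N] that w c by metis
          then have "EU u1 (pure a) y = c" if "x a \<noteq> 0" for a
            using that xy unfolding EU_pure_left by (intro weighted_sum_eqI) auto
          then show ?thesis
            unfolding EU_expand1[of u1 x y] using xy by (intro weighted_sum_eqI) auto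
        qed
        then show False using gt unfolding card_gt1_def V1_def by auto
      qed
      then obtain a a' where aa': "w a \<noteq> w a'" by blast
      have disj: "\<not> (u2 a b = v \<and> u2 a' b = v)" for b
        using u1max[of a b a'] u1max[of a' b a] w aa' by (metis antisym)
      obtain p t where p: "0 < p" "p < 1" and t: "best_resp2 MM u2 (mix p a a') t"
        and ind: "EU u1 (pure a) t = EU u1 (pure a') t"
      proof (rule indifference_on_segment[of u2 a u1 a'])
        show "(\<forall>b'. u2 a b' \<le> u2 a b) \<Longrightarrow> u1 a' b \<le> u1 a b" for b
          using u1max eqv by blast
        show "(\<forall>b'. u2 a' b' \<le> u2 a' b) \<Longrightarrow> u1 a b \<le> u1 a' b" for b
          using u1max eqv by blast
      qed
      have mx: "mix p a a' \<in> simplex" "t \<in> simplex"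
        using p t by (auto intro: mix_in_simplex simp: best_resp2_MM_iff)
      \<comment> \<open>As an equilibrium it would pay player 2 \<open>v\<close>, making every
        action in the support of \<open>t\<close> a best reply to both \<open>a\<close> and
        \<open>a'\<close>.\<close>
      have "(mix p a a', t) \<notin> Nash MM u1 u2"
      proof
        assume N: "(mix p a a', t) \<in> Nash MM u1 u2"
        have pos: "mix p a a' a \<noteq> 0" "mix p a a' a' \<noteq> 0"
          using p aa' by (auto simp: mix_def pure_apply)
        have "\<exists>b. t b \<noteq> 0" using simplex_sum[OF mx(2)] by (metis sum.neutral zero_neq_one)
        then obtain b where "t b \<noteq> 0" by blast
        then have "u2 a b = v" "u2 a' b = v"
          using EU_eq_maxD[OF mx, of u2 v _ b] lev valv[OF N] pos by blast+
        then show False using disj by blast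
      qed
      then show ?thesis
        using enforceable_if_indifferent_on_support[OF gt one _ t, of "EU u1 (pure a) t"]
          mix_support[of p a a'] ind mx by (auto simp: av)
    qed
  qed
qed

text \<open>The hypothesis makes \<open>u1\<close> independent of player 1's action and
  \<open>u2\<close> of player 2's, so mixing gains nothing. The free regime \<open>r\<close> links
  mixed profiles to pure pairs in \<open>PP\<close> too.\<close>

lemma all_pure_Nash_imp_all_Nash:
  assumes "\<And>a b. (pure a, pure b) \<in> Nash r u1 u2" "s1 \<in> simplex" "s2 \<in> simplex"
  shows "(s1, s2) \<in> Nash MM u1 u2"
proof -
  have "u1 a b \<le> u1 a' b" for a a' b
    using NashD(3)[OF assms(1)[of a' b], of "pure a"] by simp
  then have c1: "u1 a b = u1 a' b" for a a' b by (metis antisym)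
  have "u2 a b \<le> u2 a b'" for a b b'
    using NashD(4)[OF assms(1)[of a b'], of "pure b"] by simp
  then have c2: "u2 a b = u2 a b'" for a b b' by (metis antisym)
  show ?thesis
  proof (rule NashI)
    fix a
    have "EU u1 (pure a') s2 = EU u1 (pure a) s2" for a'
      unfolding EU_pure_left using c1[of a' _ a] by simp
    then have "EU u1 s1 s2 = EU u1 (pure a) s2"
      unfolding EU_expand1[of u1 s1 s2] using assms(2) by (intro weighted_sum_eqI) auto
    then show "EU u1 (pure a) s2 \<le> EU u1 s1 s2" by simp
  next
    fix b
    have "EU u2 s1 (pure b') = EU u2 s1 (pure b)" for b'
      unfolding EU_pure_right using c2[of _ b' b] by simp
    then have "EU u2 s1 s2 = EU u2 s1 (pure b)"
      unfolding EU_expand2[of u2 s1 s2] using assms(3) by (intro weighted_sum_eqI) auto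
    then show "EU u2 s1 (pure b) \<le> EU u2 s1 s2" by simp
  qed (use assms in \<open>auto simp: avail1_def avail2_def\<close>)
qed

section \<open>Equivalence with the conditions on the stage game\<close>

lemma enforceable_PP_first:
  assumes "card_gt1 (V1 PP u1 u2)" "card_one (V2 PP u1 u2)"
    and "u1 a1 a2 < u1 a1' a2" "best_resp2 PP u2 (pure a1) (pure a2)"
  shows "enforceable PP u1 u2"
proof (rule enforceable_if_indifferent_on_support[OF assms(1,2) _ assms(4)])
  show "(pure a1, pure a2) \<notin> Nash PP u1 u2"
    using assms(3) NashD(3)[of "pure a1" "pure a2" PP u1 u2 "pure a1'"] by auto
  show "pure a1 a \<noteq> 0 \<Longrightarrow> EU u1 (pure a) (pure a2) = u1 a1 a2" for a
    by (auto simp: pure_apply split: if_splits)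
qed simp

lemma in_GLS_PP_iff: "in_GLS PP u1 u2 \<longleftrightarrow> C_pp u1 u2"
proof
  assume "C_pp u1 u2"
  then consider a1 a2 where "card_gt1 (V1 PP u1 u2)" "card_gt1 (V2 PP u1 u2)"
      "(pure a1, pure a2) \<notin> Nash PP u1 u2"
    | a1 a1' a2 where "card_gt1 (V1 PP u1 u2)" "card_one (V2 PP u1 u2)"
      "u1 a1 a2 < u1 a1' a2" "best_resp2 PP u2 (pure a1) (pure a2)"
    | a1 a2 a2' where "card_one (V1 PP u1 u2)" "card_gt1 (V2 PP u1 u2)"
      "u2 a1 a2 < u2 a1 a2'" "best_resp1 PP u1 (pure a1) (pure a2)"
    unfolding C_pp_def by blast
  then have "enforceable PP u1 u2"
  proof cases
    case 1
    then show ?thesis by (rule enforceable_both)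
  next
    case 2
    then show ?thesis by (rule enforceable_PP_first)
  next
    case 3
    then have "enforceable PP (transp u2) (transp u1)"
      by (intro enforceable_PP_first[of _ _ a2 a1 a2']) (auto simp: V_flip best_resp_flip)
    then show ?thesis by (rule enforceable_flip) simp
  qed
  then show "in_GLS PP u1 u2" by (rule enforceable_imp_in_GLS)
qed (rule in_GLS_PP_imp_C_pp)

lemma in_GLS_MM_iff: "in_GLS MM u1 u2 \<longleftrightarrow> C_mm u1 u2"
proof
  assume "C_mm u1 u2"
  then consider s1 s2 where "card_gt1 (V1 MM u1 u2)" "card_gt1 (V2 MM u1 u2)"
      "s1 \<in> simplex" "s2 \<in> simplex" "(s1, s2) \<notin> Nash MM u1 u2"
    | s1 s2 a where "card_gt1 (V1 MM u1 u2)" "card_one (V2 MM u1 u2)"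
      "s1 \<in> simplex" "best_resp2 MM u2 s1 s2" "EU u1 s1 s2 < EU u1 (pure a) s2"
    | s1 s2 b where "card_one (V1 MM u1 u2)" "card_gt1 (V2 MM u1 u2)"
      "s2 \<in> simplex" "best_resp1 MM u1 s1 s2" "EU u2 s1 s2 < EU u2 s1 (pure b)"
    unfolding C_mm_def by blast
  then have "enforceable MM u1 u2"
  proof cases
    case 1
    \<comment> \<open>Rewards are built around a pure pair, so the mixed non-equilibrium is traded
      for a pure one.\<close>
    then obtain a b where "(pure a, pure b) \<notin> Nash MM u1 u2"
      using all_pure_Nash_imp_all_Nash by blast
    then show ?thesis using 1 enforceable_both by blast
  next
    case 2
    then show ?thesis by (rule enforceable_MM_first)
  next
    case 3
    then have "enforceable MM (transp u2) (transp u1)"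
      by (intro enforceable_MM_first[of _ _ s2 s1 b]) (auto simp: V_flip best_resp_flip)
    then show ?thesis by (rule enforceable_flip) simp
  qed
  then show "in_GLS MM u1 u2" by (rule enforceable_imp_in_GLS)
qed (rule in_GLS_MM_imp_C_mm)

lemma C_mm_imp_not_Nash:
  assumes "C_mm u1 u2"
  obtains s1 s2 where "s1 \<in> simplex" "s2 \<in> simplex" "(s1, s2) \<notin> Nash MM u1 u2"
  using assms unfolding C_mm_def
  by (elim disjE conjE bexE exE) (metis NashD(3,4) pure_in_avail not_less)+

theorem mainTheorem18:
  fixes u1 :: "'a::finite \<Rightarrow> 'b::finite \<Rightarrow> real" and u2 :: "'a \<Rightarrow> 'b \<Rightarrow> real"
  shows "(\<not> in_GLS PP u1 u2 \<and> in_GLS MM u1 u2) \<longleftrightarrow>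
    ((V1 PP u1 u2 = {} \<and> V2 PP u1 u2 = {} \<and> C_mm u1 u2)
     \<or> (card_one (V1 PP u1 u2) \<and> card_one (V2 PP u1 u2) \<and> C_mm u1 u2)
     \<or> (card_gt1 (V1 PP u1 u2) \<and> card_one (V2 PP u1 u2) \<and> \<not> C_pp u1 u2 \<and> C_mm u1 u2)
     \<or> (card_one (V1 PP u1 u2) \<and> card_gt1 (V2 PP u1 u2) \<and> \<not> C_pp u1 u2 \<and> C_mm u1 u2))"
    (is "?L \<longleftrightarrow> ?R")
proof -
  have L: "?L \<longleftrightarrow> \<not> C_pp u1 u2 \<and> C_mm u1 u2"
    by (simp add: in_GLS_PP_iff in_GLS_MM_iff)
  \<comment> \<open>A mixed non-equilibrium yields a pure one, so this combination of payoff sets,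
    absent from the four cases, contradicts \<open>\<not> C_pp u1 u2\<close>.\<close>
  have both: "C_pp u1 u2" 
    if gt: "card_gt1 (V1 PP u1 u2)" "card_gt1 (V2 PP u1 u2)" and mm: "C_mm u1 u2"
  proof -
    obtain s1 s2 where "s1 \<in> simplex" "s2 \<in> simplex" "(s1, s2) \<notin> Nash MM u1 u2"
      using C_mm_imp_not_Nash[OF mm] by blast
    then have "\<exists>a b. (pure a, pure b) \<notin> Nash PP u1 u2"
      using all_pure_Nash_imp_all_Nash by blast
    then show ?thesis using gt unfolding C_pp_def by blast
  qed
  have empty: "V1 PP u1 u2 = {} \<longleftrightarrow> V2 PP u1 u2 = {}"
    by (simp add: V_empty_iff)
  have not_pp: "\<not> C_pp u1 u2"
    if "V1 PP u1 u2 = {} \<or> card_one (V1 PP u1 u2) \<and> card_one (V2 PP u1 u2)"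
    using that card_one_not_gt1 card_nonempty unfolding C_pp_def by blast
  \<comment> \<open>With each payoff set empty, a singleton or larger, the rest is
    propositional.\<close>
  show ?thesis
    unfolding L
    using both empty not_pp card_trichotomy[of "V1 PP u1 u2"] card_trichotomy[of "V2 PP u1 u2"]
      card_nonempty[of "V1 PP u1 u2"] card_nonempty[of "V2 PP u1 u2"]
    by argo
qed

end
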